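(* Let $S=(a_1,a_2,\dots)$ be a non-decreasing sequence of positive integers. For every graph $G$ (with at least one vertex), $\chi_S''(G)=1$ if and only if $G$ has no edges. Moreover, there is no graph $G$ with $\chi_S''(G)=2$.
   Context: All graphs are simple and undirected, with at least one vertex. For vertices $u,v$ of $G$, $d(u,v)$ is the usual shortest-path distance (infinite if $u,v$ lie in different components). For a vertex $u$ and an edge $ab$, $d(u,ab)=d(ab,u)=\min\{d(u,a),d(u,b)\}+1$. For two distinct edges $ab,cd$, $d(ab,cd)=\min\{d(a,c),d(a,d),d(b,c),d(b,d)\}+1$. For a non-decreasing infinite sequence $S=(a_1,a_2,\ldots)$ of positive integers, an $S$-packing total coloring of $G$ using $k$ colors is a map $c:V(G)\cup E(G)\to\{1,\ldots,k\}$ such that any two distinct elements $A,B\in V(G)\cup E(G)$ with $c(A)=c(B)=i$ satisfy $d(A,B)>a_i$. The $S$-packing total chromatic number $\chi_S''(G)$ is the smallest $k$ for which one exists (it is $\infty$ if there is none). *)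

theory Defs
  imports "HOL-Library.Extended_Nat"
begin

text \<open>Graphs are given by a vertex set and a set of two-element edges; they may be infinite.\<close>

definition simple_graph :: "'a set \<Rightarrow> 'a set set \<Rightarrow> bool" where
  "simple_graph V E \<longleftrightarrow> V \<noteq> {} \<and> (\<forall>e\<in>E. \<exists>u\<in>V. \<exists>v\<in>V. u \<noteq> v \<and> e = {u, v})"

definition is_path :: "'a set \<Rightarrow> 'a set set \<Rightarrow> 'a \<Rightarrow> 'a list \<Rightarrow> 'a \<Rightarrow> bool" where
  "is_path V E u p v \<longleftrightarrow>
     p \<noteq> [] \<and> hd p = u \<and> last p = v \<and> set p \<subseteq> V \<and> distinct p \<and>
     successively (\<lambda>x y. {x, y} \<in> E) p"

text \<open>A path listing \<open>n\<close> vertices has length \<open>n - 1\<close>. The infimum over the empty set in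
  \<^typ>\<open>enat\<close> is \<open>\<infinity>\<close>.\<close>

definition vdist :: "'a set \<Rightarrow> 'a set set \<Rightarrow> 'a \<Rightarrow> 'a \<Rightarrow> enat" where
  "vdist V E u v = (INF p\<in>{p. is_path V E u p v}. enat (length p - 1))"

text \<open>The elements of \<open>V <+> E\<close> are the vertices (tagged \<open>Inl\<close>) and the edges (tagged \<open>Inr\<close>).
  The last equation is the intended distance only for two distinct edges.\<close>

fun tdist :: "'a set \<Rightarrow> 'a set set \<Rightarrow> 'a + 'a set \<Rightarrow> 'a + 'a set \<Rightarrow> enat" where
  "tdist V E (Inl u) (Inl v) = vdist V E u v"
| "tdist V E (Inl u) (Inr e) = (INF a\<in>e. vdist V E u a) + 1"
| "tdist V E (Inr e) (Inl u) = (INF a\<in>e. vdist V E u a) + 1"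
| "tdist V E (Inr e) (Inr f) = (INF a\<in>e. INF b\<in>f. vdist V E a b) + 1"

text \<open>Sequences and colors are indexed from 1; the value \<open>S 0\<close> is never used.\<close>

definition packing_total_coloring ::
    "(nat \<Rightarrow> nat) \<Rightarrow> 'a set \<Rightarrow> 'a set set \<Rightarrow> nat \<Rightarrow> ('a + 'a set \<Rightarrow> nat) \<Rightarrow> bool" where
  "packing_total_coloring S V E k c \<longleftrightarrow>
     (\<forall>A\<in>V <+> E. c A \<in> {1..k}) \<and>
     (\<forall>A\<in>V <+> E. \<forall>B\<in>V <+> E. A \<noteq> B \<and> c A = c B \<longrightarrow> tdist V E A B > enat (S (c A)))"

definition packing_total_chromatic_number ::
    "(nat \<Rightarrow> nat) \<Rightarrow> 'a set \<Rightarrow> 'a set set \<Rightarrow> enat" where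
  "packing_total_chromatic_number S V E =
     (INF k\<in>{k. \<exists>c. packing_total_coloring S V E k c}. enat k)"

end

theory Submission
  imports Defs
begin

text \<open>
  An edge together with its two endpoints forms three elements at pairwise distance at most 1
  (in the total graph they span a triangle). Since every entry of the sequence is positive,
  distinct elements of equal color lie at distance at least 2, so these three receive different colors:
  a graph with an edge needs at least three colors (\<open>three_le_packing_total_chromatic_number\<close>).
  In a graph without edges, distinct vertices lie in different components, hence at infinite
  distance, and a single color is enough however large the first entry of the sequence is
  (\<open>packing_total_chromatic_number_edgeless\<close>). So the number is either 1 or at least 3.
\<close>

lemma vdist_le_path: "is_path V E u p v \<Longrightarrow> vdist V E u v \<le> enat (length p - 1)"
  unfolding vdist_def by (rule INF_lower) simp

lemma vdist_refl: "u \<in> V \<Longrightarrow> vdist V E u u = 0"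
  using vdist_le_path[of V E u "[u]" u] by (simp add: is_path_def zero_enat_def[symmetric])

lemma vdist_adjacent_le:
  assumes "u \<in> V" "v \<in> V" "u \<noteq> v" "{u, v} \<in> E"
  shows "vdist V E u v \<le> 1"
  using vdist_le_path[of V E u "[u, v]" v] assms by (simp add: is_path_def one_enat_def)

lemma tdist_incident_le:
  assumes "u \<in> V" "u \<in> e"
  shows "tdist V E (Inl u) (Inr e) \<le> 1"
proof -
  have "(INF a\<in>e. vdist V E u a) \<le> vdist V E u u"
    using assms(2) by (rule INF_lower)
  then show ?thesis
    using vdist_refl[OF assms(1)] by simp
qed

text \<open>
  Colors start at 1, where every entry of the sequence is positive; an entry at least 1 already
  forbids repeating a color at distance at most 1.
\<close>

lemma color_neq_if_tdist_le_1:
  assumes S: "\<forall>i\<ge>1. S i > 0"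
    and c: "packing_total_coloring S V E k c"
    and AB: "A \<in> V <+> E" "B \<in> V <+> E" "A \<noteq> B" "tdist V E A B \<le> 1"
  shows "c A \<noteq> c B"
proof
  assume "c A = c B"
  then have "enat (S (c A)) < tdist V E A B" and "c A \<in> {1..k}"
    using c AB(1-3) by (simp_all add: packing_total_coloring_def)
  then have "enat (S (c A)) < 1" and "c A \<ge> 1"
    using AB(4) by (auto dest: order.strict_trans2)
  with S show False
    by (auto simp: one_enat_def)
qed

lemma three_le_packing_total_chromatic_number:
  assumes S: "\<forall>i\<ge>1. S i > 0" and G: "simple_graph V E" and "E \<noteq> {}"
  shows "3 \<le> packing_total_chromatic_number S V E"
proof -
  obtain e where "e \<in> E"
    using \<open>E \<noteq> {}\<close> by blast
  with G obtain u v where uv: "u \<in> V" "v \<in> V" "u \<noteq> v" "{u, v} \<in> E"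
    unfolding simple_graph_def by metis
  have "3 \<le> k" if c: "packing_total_coloring S V E k c" for k c
  proof -
    let ?T = "{Inl u, Inl v, Inr {u, v}}"
    have T: "?T \<subseteq> V <+> E"
      using uv by auto
    have "c (Inl u) \<noteq> c (Inl v)"
      using T uv vdist_adjacent_le[OF uv] by (intro color_neq_if_tdist_le_1[OF S c]) simp_all
    moreover have "c (Inl x) \<noteq> c (Inr {u, v})" if "x \<in> {u, v}" for x
    proof (rule color_neq_if_tdist_le_1[OF S c])
      show "tdist V E (Inl x) (Inr {u, v}) \<le> 1"
        using uv that by (intro tdist_incident_le) auto
    qed (use uv that in auto)
    ultimately have "card (c ` ?T) = 3"
      by (simp add: card_insert_if)
    moreover have "c ` ?T \<subseteq> {1..k}"
      using c T unfolding packing_total_coloring_def by blast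
    then have "card (c ` ?T) \<le> k"
      using card_mono[of "{1..k}" "c ` ?T"] by simp
    ultimately show ?thesis
      by simp
  qed
  then show ?thesis
    unfolding packing_total_chromatic_number_def
    by (auto intro!: INF_greatest simp: numeral_eq_enat)
qed

text \<open>
  A path between distinct vertices has at least two entries, and its first two form an edge.
\<close>

lemma vdist_edgeless:
  assumes "u \<noteq> v"
  shows "vdist V {} u v = \<infinity>"
proof -
  have "\<not> is_path V {} u p v" for p
    using assms by (cases p rule: remdups_adj.cases) (auto simp: is_path_def)
  then show ?thesis
    by (simp add: vdist_def top_enat_def)
qed

lemma packing_total_chromatic_number_edgeless:
  assumes "V \<noteq> {}"
  shows "packing_total_chromatic_number S V {} = 1"
proof (rule antisym)
  have "enat (S 1) < tdist V {} A B" if "A \<in> V <+> {}" "B \<in> V <+> {}" "A \<noteq> B" for A B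
    using that by (elim PlusE) (simp_all add: vdist_edgeless)
  then have "packing_total_coloring S V {} 1 (\<lambda>_. 1)"
    by (simp add: packing_total_coloring_def)
  then show "packing_total_chromatic_number S V {} \<le> 1"
    unfolding packing_total_chromatic_number_def one_enat_def by (intro INF_lower) blast
  have "1 \<le> k" if "packing_total_coloring S V {} k c" for k c
    using that assms by (fastforce simp: packing_total_coloring_def)
  then show "1 \<le> packing_total_chromatic_number S V {}"
    unfolding packing_total_chromatic_number_def one_enat_def by (auto intro!: INF_greatest)
qed

theorem proposition5:
  fixes S :: "nat \<Rightarrow> nat"
  assumes "\<forall>i\<ge>1. S i > 0"
    and "mono_on {1..} S"
  shows "(\<forall>(V :: 'a set) E. simple_graph V E \<longrightarrow>
            (packing_total_chromatic_number S V E = 1 \<longleftrightarrow> E = {})) \<and>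
         \<not> (\<exists>(V :: 'a set) E. simple_graph V E \<and> packing_total_chromatic_number S V E = 2)"
proof -
  have edgeless: "packing_total_chromatic_number S V E = 1"
    if "simple_graph V E" "E = {}" for V :: "'a set" and E
    using that packing_total_chromatic_number_edgeless[of V S] by (simp add: simple_graph_def)
  have edge: "3 \<le> packing_total_chromatic_number S V E"
    if "simple_graph V E" "E \<noteq> {}" for V :: "'a set" and E
    using three_le_packing_total_chromatic_number[OF assms(1)] that .
  have "\<not> (3::enat) \<le> 1" "\<not> (3::enat) \<le> 2" "(1::enat) \<noteq> 2"
    by (simp_all add: one_enat_def numeral_eq_enat)
  with edgeless edge show ?thesis
    by metis
qed

end
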